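(* For any $a,b>0$ and $v\in[0,1]$ we have $$L_v^*(a,b)=L^*\big(a\sharp_v b,a\big)\,!_v\,L^*\big(a\sharp_v b,b\big)$$ and $$I_v^*(a,b)=I^*\big(a!_v b,a\big)\,\sharp_v\,I^*\big(a!_v b,b\big).$$
   Context: For $a,b>0$ and $v\in[0,1]$: $a\nabla_v b=(1-v)a+vb$, $a\sharp_v b=a^{1-v}b^v$ and $a!_v b=\big((1-v)a^{-1}+vb^{-1}\big)^{-1}$. The logarithmic mean is $L(a,b)=\frac{b-a}{\log b-\log a}$ for $a\ne b$, $L(a,a)=a$. The identric mean is $I(a,b)=e^{-1}\big(b^b/a^a\big)^{1/(b-a)}$ for $a\neq b$, $I(a,a)=a$. The weighted logarithmic mean $L_v$ and the weighted identric mean $I_v$ are defined, for $a\ne b$ and $v\in(0,1)$, by $$L_v(a,b)=\frac{1}{\log a-\log b}\left(\frac{1-v}{v}\big(a-a^{1-v}b^v\big)+\frac{v}{1-v}\big(a^{1-v}b^v-b\big)\right),$$ $$I_v(a,b)=\frac1e\,\big(a\nabla_v b\big)^{\frac{(1-2v)(a\nabla_v b)}{v(1-v)(b-a)}}\left(\frac{b^{\frac{vb}{1-v}}}{a^{\frac{(1-v)a}{v}}}\right)^{\frac1{b-a}},$$ with the limit values $L_0(a,b)=I_0(a,b)=a$, $L_1(a,b)=I_1(a,b)=b$, and $L_v(a,a)=I_v(a,a)=a$. The dual of a mean $m$ is $m^*(a,b)=\big(m(a^{-1},b^{-1})\big)^{-1}$; thus $L^*,I^*,L_v^*,I_v^*$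 are the duals of $L,I,L_v,I_v$, respectively. *)

theory Defs
  imports Complex_Main
begin

definition weighted_arith_mean :: "real \<Rightarrow> real \<Rightarrow> real \<Rightarrow> real" where
  "weighted_arith_mean v a b = (1 - v) * a + v * b"

definition weighted_geom_mean :: "real \<Rightarrow> real \<Rightarrow> real \<Rightarrow> real" where
  "weighted_geom_mean v a b = a powr (1 - v) * b powr v"

definition weighted_harm_mean :: "real \<Rightarrow> real \<Rightarrow> real \<Rightarrow> real" where
  "weighted_harm_mean v a b = inverse ((1 - v) * inverse a + v * inverse b)"

definition log_mean :: "real \<Rightarrow> real \<Rightarrow> real" where
  "log_mean a b = (if a = b then a else (b - a) / (ln b - ln a))"

definition identric_mean :: "real \<Rightarrow> real \<Rightarrow> real" where
  "identric_mean a b =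
     (if a = b then a else exp (-1) * (b powr b / a powr a) powr (1 / (b - a)))"

text \<open>The weighted logarithmic and identric means are given by their formulas only for
  \<open>a \<noteq> b\<close> and \<open>0 < v < 1\<close>; the remaining cases are the limit values, fixed here explicitly.\<close>

definition weighted_log_mean :: "real \<Rightarrow> real \<Rightarrow> real \<Rightarrow> real" where
  "weighted_log_mean v a b =
     (if v = 0 then a else if v = 1 then b else if a = b then a
      else 1 / (ln a - ln b) *
        ((1 - v) / v * (a - a powr (1 - v) * b powr v)
         + v / (1 - v) * (a powr (1 - v) * b powr v - b)))"

definition weighted_identric_mean :: "real \<Rightarrow> real \<Rightarrow> real \<Rightarrow> real" where
  "weighted_identric_mean v a b =
     (if v = 0 then a else if v = 1 then b else if a = b then a
      else 1 / exp 1
        * weighted_arith_mean v a b powr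
            ((1 - 2 * v) * weighted_arith_mean v a b / (v * (1 - v) * (b - a)))
        * (b powr (v * b / (1 - v)) / a powr ((1 - v) * a / v)) powr (1 / (b - a)))"

definition dual_mean :: "(real \<Rightarrow> real \<Rightarrow> real) \<Rightarrow> real \<Rightarrow> real \<Rightarrow> real" where
  "dual_mean m a b = inverse (m (inverse a) (inverse b))"

end

theory Submission
  imports Defs
begin

text \<open>Passing to \<open>x = 1/a\<close>, \<open>y = 1/b\<close> removes the duals and exchanges harmonic and arithmetic
  means. What remains is that \<open>L\<^sub>v(x,y)\<close> is the weighted arithmetic mean of \<open>L(g,x)\<close> and \<open>L(g,y)\<close>
  with \<open>g\<close> the weighted geometric mean, and that \<open>I\<^sub>v(x,y)\<close> is the weighted geometric mean of
  \<open>I(m,x)\<close> and \<open>I(m,y)\<close> with \<open>m\<close> the weighted arithmetic mean. Both are computations: \<open>g\<close> divides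
  the segment from \<open>ln x\<close> to \<open>ln y\<close> in the ratio \<open>v : 1 - v\<close>, and \<open>m\<close> does so for the segment from
  \<open>x\<close> to \<open>y\<close>, so the denominators of the unweighted means are multiples of \<open>ln x - ln y\<close> and
  \<open>x - y\<close>.\<close>

lemma weighted_arith_mean_pos:
  assumes "0 < x" "0 < y" "0 \<le> v" "v \<le> 1"
  shows "0 < weighted_arith_mean v x y"
proof (cases "v = 0")
  case False
  then have "0 < v * y" using assms by simp
  moreover have "0 \<le> (1 - v) * x" using assms by simp
  ultimately show ?thesis by (simp add: weighted_arith_mean_def)
qed (use assms in \<open>simp add: weighted_arith_mean_def\<close>)

lemma weighted_geom_mean_pos: "0 < x \<Longrightarrow> 0 < y \<Longrightarrow> 0 < weighted_geom_mean v x y"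
  by (simp add: weighted_geom_mean_def)

lemma ln_weighted_geom_mean:
  assumes "0 < x" "0 < y"
  shows "ln (weighted_geom_mean v x y) = (1 - v) * ln x + v * ln y"
  using assms by (simp add: weighted_geom_mean_def ln_mult ln_powr)

text \<open>The geometric mean is self-dual, so it survives the passage to reciprocals both as inner
  mean (first identity) and as outer mean (second).\<close>

lemma inverse_weighted_geom_mean:
  "inverse (weighted_geom_mean v x y) = weighted_geom_mean v (inverse x) (inverse y)"
  by (simp add: weighted_geom_mean_def inverse_powr)

lemma inverse_weighted_harm_mean:
  "inverse (weighted_harm_mean v x y) = weighted_arith_mean v (inverse x) (inverse y)"
  by (simp add: weighted_harm_mean_def weighted_arith_mean_def)

lemma weighted_harm_mean_inverse:
  "weighted_harm_mean v (inverse x) (inverse y) = inverse (weighted_arith_mean v x y)"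
  by (simp add: weighted_harm_mean_def weighted_arith_mean_def)

lemma identric_mean_pos: "0 < x \<Longrightarrow> 0 < y \<Longrightarrow> 0 < identric_mean x y"
  by (simp add: identric_mean_def)

text \<open>Since \<open>t * ln t - t\<close> is a primitive of \<open>ln\<close>, this is the
  average of \<open>ln\<close> between \<open>x\<close> and \<open>y\<close>.\<close>

lemma ln_identric_mean:
  assumes "0 < x" "0 < y" "x \<noteq> y"
  shows "ln (identric_mean x y) = (y * ln y - x * ln x) / (y - x) - 1"
  using assms by (simp add: identric_mean_def ln_mult ln_powr ln_div)

lemma weighted_log_mean_eq_arith_mean:
  fixes v x y :: real
  assumes "0 < x" "0 < y"
  defines "g \<equiv> weighted_geom_mean v x y"
  shows "weighted_log_mean v x y = weighted_arith_mean v (log_mean g x) (log_mean g y)"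
proof -
  consider "v = 0" | "v = 1" | "x = y" | "v \<noteq> 0" "v \<noteq> 1" "x \<noteq> y" by blast
  then show ?thesis
  proof cases
    case 4
    define d where "d = ln x - ln y"
    have d: "d \<noteq> 0" using assms 4 by (simp add: d_def)
    have g: "ln g = (1 - v) * ln x + v * ln y"
      using assms ln_weighted_geom_mean by simp
    have gx: "ln x - ln g = v * d" and gy: "ln y - ln g = - ((1 - v) * d)"
      unfolding g d_def by algebra+
    have ne: "g \<noteq> x" "g \<noteq> y" using gx gy d 4 by auto
    have "weighted_log_mean v x y
        = 1 / d * ((1 - v) / v * (x - g) + v / (1 - v) * (g - y))"
      using 4 by (simp add: weighted_log_mean_def g_def weighted_geom_mean_def d_def)
    also have "\<dots> = (1 - v) * ((x - g) / (v * d)) + v * ((y - g) / (- ((1 - v) * d)))"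
    proof -
      \<comment> \<open>With \<open>1 - v\<close> as an atom, \<open>field_simps\<close> clears it
        as a denominator without expanding it.\<close>
      define w where "w = 1 - v"
      have "w \<noteq> 0" using 4 by (simp add: w_def)
      then show ?thesis unfolding w_def[symmetric] using 4 d
        by (simp add: field_simps)
    qed
    finally show ?thesis
      using ne by (simp add: weighted_arith_mean_def log_mean_def gx gy)
  qed (use assms in \<open>simp_all add: weighted_log_mean_def weighted_arith_mean_def log_mean_def
         weighted_geom_mean_def algebra_simps flip: powr_add\<close>)
qed

lemma weighted_identric_mean_eq_geom_mean:
  fixes v x y :: real
  assumes "0 < x" "0 < y" "0 \<le> v" "v \<le> 1"
  defines "m \<equiv> weighted_arith_mean v x y"
  shows "weighted_identric_mean v x y
    = weighted_geom_mean v (identric_mean m x) (identric_mean m y)"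
proof -
  have m: "0 < m" using assms weighted_arith_mean_pos by simp
  \<comment> \<open>Positivity matters at the endpoints too: \<open>0 powr 0 = 0\<close>, so a
    factor of weight 0 is 1 only for a nonzero base.\<close>
  have I: "0 < identric_mean m x" "0 < identric_mean m y"
    using assms m identric_mean_pos by auto
  consider "v = 0" | "v = 1" | "x = y" | "v \<noteq> 0" "v \<noteq> 1" "x \<noteq> y" by blast
  then show ?thesis
  proof cases
    case 1
    then show ?thesis using I
      by (simp add: weighted_identric_mean_def weighted_geom_mean_def m_def
          weighted_arith_mean_def identric_mean_def)
  next
    case 2
    then show ?thesis using I
      by (simp add: weighted_identric_mean_def weighted_geom_mean_def m_def
          weighted_arith_mean_def identric_mean_def)
  next
    case 3
    then have "m = x" by (simp add: m_def weighted_arith_mean_def algebra_simps)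
    then show ?thesis using 3 assms(1)
      by (simp add: weighted_identric_mean_def weighted_geom_mean_def identric_mean_def
          flip: powr_add)
  next
    case 4
    define w d where "w = 1 - v" and "d = y - x"
    have nz: "v \<noteq> 0" "w \<noteq> 0" "d \<noteq> 0" using 4 by (auto simp: w_def d_def)
    have mx: "x - m = - (v * d)" and my: "y - m = w * d"
      unfolding m_def weighted_arith_mean_def w_def d_def by algebra+
    have ne: "m \<noteq> x" "m \<noteq> y" using mx my nz by auto
    have eq: "weighted_identric_mean v x y = 1 / exp 1 * m powr ((1 - 2 * v) * m / (v * w * d))
        * (y powr (v * y / w) / x powr (w * x / v)) powr (1 / d)"
      using 4 by (simp add: weighted_identric_mean_def m_def w_def d_def)
    have pos: "0 < weighted_identric_mean v x y"
      unfolding eq using assms m by simp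
    have "ln (weighted_identric_mean v x y)
        = (1 - 2 * v) * m / (v * w * d) * ln m + (v * y / w * ln y - w * x / v * ln x) / d - 1"
      unfolding eq using assms(1,2) m by (simp add: ln_mult ln_powr ln_div)
    \<comment> \<open>Here \<open>w + v = 1\<close> is used up: the coefficient of
      \<open>ln m\<close> becomes the difference of \<open>w * m / (v * d)\<close> and
      \<open>v * m / (w * d)\<close>, and the constant 1 is shared out by weight. The next step then
      holds for independent \<open>v\<close> and \<open>w\<close>.\<close>
    also have "\<dots> = (w * w - v * v) * m / (v * w * d) * ln m
        + (v * y / w * ln y - w * x / v * ln x) / d - (w + v)"
    proof -
      have "w * w - v * v = 1 - 2 * v" "w + v = 1" unfolding w_def by algebra+
      then show ?thesis by simp
    qed
    also have "\<dots> = w * ((x * ln x - m * ln m) / (- (v * d)) - 1)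
        + v * ((y * ln y - m * ln m) / (w * d) - 1)"
      using nz by (simp add: field_simps)
    also have "\<dots> = w * ln (identric_mean m x) + v * ln (identric_mean m y)"
      using assms(1,2) m ne by (simp add: ln_identric_mean mx my)
    also have "\<dots> = ln (weighted_geom_mean v (identric_mean m x) (identric_mean m y))"
      using I by (simp add: ln_weighted_geom_mean w_def)
    finally show ?thesis
      using pos I weighted_geom_mean_pos by simp
  qed
qed

theorem theorem2p6:
  fixes a b v :: real
  assumes "a > 0" and "b > 0" and "0 \<le> v" and "v \<le> 1"
  shows "dual_mean (weighted_log_mean v) a b =
           weighted_harm_mean v
             (dual_mean log_mean (weighted_geom_mean v a b) a)
             (dual_mean log_mean (weighted_geom_mean v a b) b)
       \<and> dual_mean (weighted_identric_mean v) a b =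
           weighted_geom_mean v
             (dual_mean identric_mean (weighted_harm_mean v a b) a)
             (dual_mean identric_mean (weighted_harm_mean v a b) b)"
  using assms
  by (simp add: dual_mean_def inverse_weighted_harm_mean weighted_harm_mean_inverse
      weighted_log_mean_eq_arith_mean weighted_identric_mean_eq_geom_mean
      inverse_weighted_geom_mean)

end
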